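(* Let $\sigma\in\mathcal K$. Then there is no function $\psi:\Omega\to\mathbb R$ such that for every $t\in\mathbb N$, $\nu^{(\sigma)}_{m+t}\leqslant\psi$ a.e. in $\Omega$.
   Context: Here $\mathbb N=\{1,2,\dots\}$, $n\in\mathbb N$, $n\geqslant 2$, $\Omega$ is a bounded domain (nonempty open connected set) of $\mathbb R^n$, and $|\cdot|$ is the Euclidean norm. For $y\in\mathbb R^n$, $\rho>0$ let $B(y,\rho)=\{x\in\mathbb R^n:|x-y|<\rho\}$; for $y\in\mathbb R^n$, $t\in\mathbb N$ let $Q_t(y)=\{x\in\mathbb R^n:|x_i-y_i|<\frac1{2t},\ i=1,\dots,n\}$. Let $Y_t=\{y\in\mathbb R^n: t y_i\in\mathbb Z,\ i=1,\dots,n\}$ and $X_t=\{y\in Y_t: Q_t(y)\subset\Omega\}$. A number $m\in\mathbb N$ is fixed such that $X_t\neq\emptyset$ for every $t\in\mathbb N$, $t>m$ (such $m$ exists). For $t>m$ let $G_t=\bigcup_{y\in X_t}B(y,\frac1{2t})\subset\Omega$, let $\chi_t:\Omega\to\mathbb R$ be the characteristic function of $G_t$ and, for $y\in X_t$, let $\chi_{t,y}:\Omega\to\mathbb R$ be the characteristic function of $B(y,\frac1{2t})$. $\mathcal K$ is the set of all functions $\sigma:[0,+\infty)\to(0,+\infty)$ such that: (i) $\sigma$ is continuous in $(0,+\infty)$; (ii) $\sigma\geqslant1$ in $[0,1]$; (iii) $\sigma(\rho)\to+\infty$ as $\rho>0$, $\rho\to0$; (iv) $\int_0^1\sigma(\rho)\rho^{n-1}d\rho<+\infty$.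 For $\sigma\in\mathcal K$ and $t\in\mathbb N$, $t>m$, the function $\nu_t^{(\sigma)}:\Omega\to\mathbb R$ is defined by $\nu_t^{(\sigma)}(x)=\sigma(1)(1-\chi_t(x))+\sum_{y\in X_t}\sigma(2t|x-y|)\chi_{t,y}(x)$. The function $\psi$ in the claim is not assumed measurable. *)

theory Defs
  imports "HOL-Analysis.Analysis"
begin

text \<open>The dimension is \<open>n = CARD('n)\<close>. Where \<open>t\<close> is a divisor, only \<open>t > 0\<close> is meaningful.\<close>

definition Q_cube :: "nat \<Rightarrow> real ^ 'n \<Rightarrow> (real ^ 'n) set" where
  "Q_cube t y = {x. \<forall>i. \<bar>x $ i - y $ i\<bar> < 1 / (2 * real t)}"

definition Y_set :: "nat \<Rightarrow> (real ^ 'n) set" where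
  "Y_set t = {y. \<forall>i. real t * y $ i \<in> \<int>}"

definition X_set :: "(real ^ 'n) set \<Rightarrow> nat \<Rightarrow> (real ^ 'n) set" where
  "X_set \<Omega> t = {y \<in> Y_set t. Q_cube t y \<subseteq> \<Omega>}"

definition G_set :: "(real ^ 'n) set \<Rightarrow> nat \<Rightarrow> (real ^ 'n) set" where
  "G_set \<Omega> t = (\<Union>y \<in> X_set \<Omega> t. ball y (1 / (2 * real t)))"

text \<open>A function on \<open>[0, \<infinity>)\<close> is represented by a function on all reals whose values at
  negative arguments are left unconstrained. The integral in the last condition is a Lebesgue
  integral; its integrand is nonnegative and, by continuity on \<open>(0, \<infinity>)\<close>, Borel measurable
  on \<open>[0, 1]\<close>, so integrability there means exactly that the integral is finite.\<close>

definition K_class :: "nat \<Rightarrow> (real \<Rightarrow> real) set" where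
  "K_class n = {\<sigma>.
     (\<forall>\<rho>\<ge>0. \<sigma> \<rho> > 0) \<and>
     continuous_on {0<..} \<sigma> \<and>
     (\<forall>\<rho>\<in>{0..1}. \<sigma> \<rho> \<ge> 1) \<and>
     filterlim \<sigma> at_top (at_right 0) \<and>
     set_integrable lborel {0..1} (\<lambda>\<rho>. \<sigma> \<rho> * \<rho> ^ (n - 1))}"

text \<open>For bounded \<open>\<Omega>\<close> and \<open>t > 0\<close> the set \<open>X_set \<Omega> t\<close> is finite, so the sum below is the
  genuine one. Only the values at points of \<open>\<Omega>\<close> are meaningful.\<close>

definition \<nu> :: "(real ^ 'n) set \<Rightarrow> (real \<Rightarrow> real) \<Rightarrow> nat \<Rightarrow> real ^ 'n \<Rightarrow> real" where
  "\<nu> \<Omega> \<sigma> t x =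
     \<sigma> 1 * (1 - indicator (G_set \<Omega> t) x) +
     (\<Sum>y \<in> X_set \<Omega> t. \<sigma> (2 * real t * norm (x - y)) * indicator (ball y (1 / (2 * real t))) x)"

end

theory Submission
  imports Defs
begin

text \<open>By recurrence of rotations of the torus, for every \<open>x\<close> and every \<open>\<epsilon> > 0\<close> there are
  arbitrarily large \<open>t\<close> such that \<open>t x\<close> is within \<open>\<epsilon>\<close> of an integer vector \<open>t y\<close>. If \<open>x \<in> \<Omega>\<close> and
  \<open>t\<close> is large, then \<open>y \<in> X\<^sub>t\<close> and the summand of \<open>y\<close> in \<open>\<nu>\<^sub>t x\<close> is \<open>\<sigma> (2 t \<bar>x - y\<bar>)\<close>, with an
  argument below \<open>2 \<epsilon>\<close>. It is positive unless \<open>x\<close> is a rational point, so \<open>\<nu>\<^sub>t x\<close> is unbounded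
  in \<open>t\<close> for every \<open>x \<in> \<Omega>\<close> outside a countable set.\<close>

text \<open>Compactness of the unit cube forces the coordinatewise fractional parts of the multiples
  of \<open>x\<close> to cluster; the difference of two indices with nearby fractional parts serves
  as \<open>t\<close>.\<close>

lemma torus_rotation_recurrent:
  fixes x :: "real ^ 'n"
  assumes "e > 0"
  obtains t p where "t \<ge> N" "\<And>i. p $ i \<in> \<int>" "norm (real t *\<^sub>R x - p) < e"
proof -
  define f :: "nat \<Rightarrow> real ^ 'n" where "f k = (\<chi> i. frac (real k * x $ i))" for k
  have "\<forall>k. f k \<in> cbox 0 1"
    by (auto simp: f_def mem_box_cart frac_ge_0 less_imp_le[OF frac_lt_1])
  then obtain l r where r: "strict_mono r" and "(f \<circ> r) \<longlonglongrightarrow> l"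
    using compact_cbox[of "0 :: real ^ 'n" 1] unfolding compact_def by metis
  then have "Cauchy (f \<circ> r)"
    by (simp add: LIMSEQ_imp_Cauchy)
  then obtain M where M: "\<And>i j. i \<ge> M \<Longrightarrow> j \<ge> M \<Longrightarrow> dist ((f \<circ> r) i) ((f \<circ> r) j) < e"
    using assms unfolding Cauchy_def by meson
  \<comment> \<open>Strict growth of \<open>r\<close> keeps the two chosen indices at least
    \<open>N\<close> apart, which makes \<open>t\<close> as large as required.\<close>
  have grow: "r (M + k) \<ge> r M + k" for k
  proof (induction k)
    case (Suc k)
    then show ?case
      using strict_monoD[OF r, of "M + k" "M + Suc k"] by simp
  qed simp
  define t where "t = r (M + N) - r M"
  \<comment> \<open>In this form the error is a difference of two close terms of \<open>f\<close>,
    while \<open>p\<close> itself reduces to a difference of floors and so is integral.\<close>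
  define p where "p = real t *\<^sub>R x - (f (r (M + N)) - f (r M))"
  show thesis
  proof
    show "t \<ge> N"
      using grow[of N] by (simp add: t_def)
    have "real (r (M + N)) = real t + real (r M)"
      using grow[of N] by (simp add: t_def of_nat_diff)
    then have "p $ i = of_int (\<lfloor>real (r (M + N)) * x $ i\<rfloor> - \<lfloor>real (r M) * x $ i\<rfloor>)" for i
      by (simp add: p_def f_def frac_def algebra_simps)
    then show "p $ i \<in> \<int>" for i
      by (metis Ints_of_int)
    show "norm (real t *\<^sub>R x - p) < e"
      using M[of "M + N" M] by (simp add: p_def dist_norm)
  qed
qed

lemma Y_set_approx:
  fixes x :: "real ^ 'n"
  assumes "e > 0"
  obtains t y where "t > N" "y \<in> Y_set t" "real t * norm (x - y) < e"
proof -
  obtain t p where t: "t \<ge> Suc N" and p: "\<And>i. p $ i \<in> \<int>" and "norm (real t *\<^sub>R x - p) < e"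
    using torus_rotation_recurrent[OF assms, of "Suc N" x] by blast
  moreover have "real t *\<^sub>R x - p = real t *\<^sub>R (x - (1 / real t) *\<^sub>R p)"
    using t by (simp add: algebra_simps)
  ultimately have "real t * norm (x - (1 / real t) *\<^sub>R p) < e"
    by simp
  moreover have "(1 / real t) *\<^sub>R p \<in> Y_set t"
    using t p by (simp add: Y_set_def)
  ultimately show thesis
    using that[of t "(1 / real t) *\<^sub>R p"] t by simp
qed

lemma Y_set_rational:
  assumes "t > 0" "y \<in> Y_set t"
  shows "y $ i \<in> \<rat>"
proof -
  have "real t * y $ i \<in> \<rat>"
    using assms Ints_subset_Rats by (auto simp: Y_set_def)
  then have "real t * y $ i / real t \<in> \<rat>"
    by (intro Rats_divide) auto
  then show ?thesis
    using assms by simp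
qed

lemma countable_rational_points: "countable {x :: real ^ 'n. \<forall>i. x $ i \<in> \<rat>}"
proof (rule countable_subset)
  show "{x :: real ^ 'n. \<forall>i. x $ i \<in> \<rat>} \<subseteq> vec_lambda ` (PiE UNIV (\<lambda>_. \<rat>))"
    by (auto intro!: image_eqI[of _ _ "vec_nth _"])
  show "countable (vec_lambda ` (PiE (UNIV :: 'n set) (\<lambda>_. \<rat> :: real set)))"
    by (intro countable_image countable_PiE countable_rat) auto
qed

text \<open>Each centre lies in its own cube. For \<open>t = 0\<close> the cube would be empty,
  since \<open>1 / 0 = 0\<close>, and every point would belong to \<open>X_set\<close>.\<close>

lemma X_set_subset:
  assumes "t > 0"
  shows "X_set \<Omega> t \<subseteq> \<Omega>"
  using assms by (force simp: X_set_def Q_cube_def)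

text \<open>Coordinates are multiples of \<open>1 / t\<close> in a bounded range. Finiteness makes
  the sum in \<open>\<nu>\<close> genuine: a sum over an infinite set is 0 by convention.\<close>

lemma finite_X_set:
  fixes \<Omega> :: "(real ^ 'n) set"
  assumes "bounded \<Omega>" "t > 0"
  shows "finite (X_set \<Omega> t)"
proof -
  obtain B where B: "\<And>y. y \<in> \<Omega> \<Longrightarrow> norm y \<le> B"
    using assms(1) by (auto simp: bounded_iff)
  define C where "C = (\<lambda>k. real_of_int k / real t) ` {\<lfloor>- (real t * B)\<rfloor>..\<lceil>real t * B\<rceil>}"
  have "y $ i \<in> C" if "y \<in> X_set \<Omega> t" for y i
  proof -
    have "real t * y $ i \<in> \<int>"
      using that by (simp add: X_set_def Y_set_def)
    then obtain k where k: "real t * y $ i = of_int k"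
      by (rule Ints_cases)
    have "\<bar>y $ i\<bar> \<le> B"
      using B X_set_subset[OF assms(2)] that component_le_norm_cart[of y i] by force
    then have "\<bar>real t * y $ i\<bar> \<le> real t * B"
      by (simp add: abs_mult mult_left_mono)
    then have "k \<in> {\<lfloor>- (real t * B)\<rfloor>..\<lceil>real t * B\<rceil>}"
      unfolding k by (auto simp: abs_le_iff) linarith+
    moreover have "y $ i = of_int k / real t"
      using k assms(2) by (simp add: field_simps)
    ultimately show ?thesis
      unfolding C_def by blast
  qed
  then have "X_set \<Omega> t \<subseteq> vec_lambda ` (PiE UNIV (\<lambda>_. C))"
    by (auto intro!: image_eqI[of _ _ "vec_nth _"])
  moreover have "finite (vec_lambda ` (PiE (UNIV :: 'n set) (\<lambda>_. C)))"
    by (intro finite_imageI finite_PiE) (auto simp: C_def)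
  ultimately show ?thesis
    by (rule finite_subset)
qed

lemma Q_cube_subset_ball:
  fixes y :: "real ^ 'n"
  assumes "t > 0"
  shows "Q_cube t y \<subseteq> ball y (real CARD('n) / real t)"
proof
  fix z assume "z \<in> Q_cube t y"
  then have "norm (z - y) \<le> (\<Sum>i\<in>(UNIV :: 'n set). 1 / (2 * real t))"
    by (intro order_trans[OF norm_le_l1_cart] sum_mono) (auto simp: Q_cube_def less_imp_le)
  also have "\<dots> < real CARD('n) / real t"
    using assms by (simp add: field_simps)
  finally show "z \<in> ball y (real CARD('n) / real t)"
    by (simp add: dist_norm norm_minus_commute)
qed

text \<open>All terms of \<open>\<nu>\<close> are nonnegative, so any one summand bounds it from
  below; an argument below 1 says that \<open>x\<close> lies in the ball around
  \<open>y\<close>.\<close>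

lemma \<nu>_ge:
  fixes \<Omega> :: "(real ^ 'n) set"
  assumes \<sigma>: "\<And>\<rho>. \<rho> \<ge> 0 \<Longrightarrow> \<sigma> \<rho> > 0"
    and "bounded \<Omega>" "t > 0" and y: "y \<in> X_set \<Omega> t" "2 * real t * norm (x - y) < 1"
  shows "\<sigma> (2 * real t * norm (x - y)) \<le> \<nu> \<Omega> \<sigma> t x"
proof -
  let ?s = "\<lambda>y. \<sigma> (2 * real t * norm (x - y)) * indicator (ball y (1 / (2 * real t))) x"
  have "x \<in> ball y (1 / (2 * real t))"
    using y assms(3) by (simp add: dist_norm norm_minus_commute field_simps)
  then have "\<sigma> (2 * real t * norm (x - y)) = ?s y"
    by simp
  also have "\<dots> \<le> (\<Sum>y \<in> X_set \<Omega> t. ?s y)"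
    by (intro member_le_sum y(1) finite_X_set assms(2,3) mult_nonneg_nonneg less_imp_le[OF \<sigma>]) auto
  also have "\<dots> \<le> \<nu> \<Omega> \<sigma> t x"
    using \<sigma>[of 1] by (simp add: \<nu>_def indicator_def)
  finally show ?thesis .
qed

lemma \<nu>_unbounded:
  fixes \<Omega> :: "(real ^ 'n) set"
  assumes "open \<Omega>" "bounded \<Omega>" "x \<in> \<Omega>" and irr: "x $ i \<notin> \<rat>"
    and pos: "\<And>\<rho>. \<rho> \<ge> 0 \<Longrightarrow> \<sigma> \<rho> > 0" and lim: "filterlim \<sigma> at_top (at_right 0)"
  obtains t where "t > m" "\<nu> \<Omega> \<sigma> t x > M"
proof -
  have "eventually (\<lambda>\<rho>. \<sigma> \<rho> > M) (at_right 0)"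
    using lim by (simp add: filterlim_at_top_dense)
  then obtain b where b: "b > 0" "\<And>\<rho>. 0 < \<rho> \<Longrightarrow> \<rho> < b \<Longrightarrow> \<sigma> \<rho> > M"
    unfolding eventually_at_right_field by blast
  obtain r where r: "r > 0" "ball x r \<subseteq> \<Omega>"
    using assms(1,3) by (meson open_contains_ball)
  \<comment> \<open>Of the numerator, \<open>CARD('n)\<close> accounts for the cube around
    \<open>y\<close> and 1 for the distance from \<open>x\<close> to \<open>y\<close>, so that the
    cube stays inside \<open>ball x r\<close>.\<close>
  obtain N :: nat where N: "real N > (real CARD('n) + 1) / r"
    using reals_Archimedean2 by blast
  \<comment> \<open>After doubling, the bound \<open>b\<close> makes \<open>\<sigma>\<close> exceed
    \<open>M\<close> and the bound 1 puts \<open>x\<close> into the ball around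
    \<open>y\<close>.\<close>
  obtain t y where t: "t > m + N" and y: "y \<in> Y_set t" "real t * norm (x - y) < min b 1 / 2"
    using Y_set_approx[of "min b 1 / 2" "m + N" x] b(1) by auto
  have "t > 0"
    using t by simp
  have small: "2 * real t * norm (x - y) < b" "2 * real t * norm (x - y) < 1"
    using y(2) by auto
  have "(real CARD('n) + 1) / r < real t"
    using N t by linarith
  then have "real CARD('n) / real t + 1 / real t < r"
    using r(1) \<open>t > 0\<close> by (simp add: field_simps)
  moreover have "norm (x - y) < 1 / real t"
    using y(2) \<open>t > 0\<close> by (simp add: field_simps)
  ultimately have "ball y (real CARD('n) / real t) \<subseteq> ball x r"
    by (simp add: ball_subset_ball_iff dist_norm norm_minus_commute)
  then have "y \<in> X_set \<Omega> t"
    using Q_cube_subset_ball[OF \<open>t > 0\<close>, of y] r(2) y(1) by (auto simp: X_set_def)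
  then have "\<sigma> (2 * real t * norm (x - y)) \<le> \<nu> \<Omega> \<sigma> t x"
    using small(2) by (intro \<nu>_ge pos assms(2) \<open>t > 0\<close>)
  \<comment> \<open>The limit at 0 from the right says nothing about \<open>\<sigma> 0\<close>, so
    the argument of \<open>\<sigma>\<close> has to be strictly positive.\<close>
  moreover have "x \<noteq> y"
    using irr Y_set_rational[OF \<open>t > 0\<close> y(1)] by auto
  then have "\<sigma> (2 * real t * norm (x - y)) > M"
    using small(1) \<open>t > 0\<close> by (intro b(2)) auto
  ultimately show thesis
    using that[of t] t by simp
qed

theorem corollary5p2:
  fixes \<Omega> :: "(real ^ 'n) set" and m :: nat and \<sigma> :: "real \<Rightarrow> real"
  assumes "CARD('n) \<ge> 2"
    and "open \<Omega>" and "connected \<Omega>" and "bounded \<Omega>" and "\<Omega> \<noteq> {}"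
    and "m \<ge> 1" and "\<forall>t>m. X_set \<Omega> t \<noteq> {}"
    and "\<sigma> \<in> K_class CARD('n)"
  shows "\<not> (\<exists>\<psi> :: real ^ 'n \<Rightarrow> real. \<forall>t\<ge>1. AE x in lebesgue_on \<Omega>. \<nu> \<Omega> \<sigma> (m + t) x \<le> \<psi> x)"
proof
  assume "\<exists>\<psi> :: real ^ 'n \<Rightarrow> real. \<forall>t\<ge>1. AE x in lebesgue_on \<Omega>. \<nu> \<Omega> \<sigma> (m + t) x \<le> \<psi> x"
  then obtain \<psi> :: "real ^ 'n \<Rightarrow> real"
    where \<psi>: "\<And>t. t \<ge> 1 \<Longrightarrow> AE x in lebesgue_on \<Omega>. \<nu> \<Omega> \<sigma> (m + t) x \<le> \<psi> x"
    by blast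
  have \<sigma>: "\<And>\<rho>. \<rho> \<ge> 0 \<Longrightarrow> \<sigma> \<rho> > 0" "filterlim \<sigma> at_top (at_right 0)"
    using assms(8) by (auto simp: K_class_def)
  have "\<Omega> \<in> sets lebesgue"
    using assms(2) by auto
  \<comment> \<open>Countably many exceptional null sets merge into one. No measurability of
    \<open>\<psi>\<close> enters, since \<open>AE\<close> only asks for a null set that contains the
    exceptions.\<close>
  have "AE x in lebesgue_on \<Omega>. \<forall>t. t \<ge> 1 \<longrightarrow> \<nu> \<Omega> \<sigma> (m + t) x \<le> \<psi> x"
    unfolding AE_all_countable using \<psi> by auto
  then have "AE x in lebesgue. x \<in> \<Omega> \<longrightarrow> (\<forall>t. t \<ge> 1 \<longrightarrow> \<nu> \<Omega> \<sigma> (m + t) x \<le> \<psi> x)"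
    using \<open>\<Omega> \<in> sets lebesgue\<close> by (simp add: AE_restrict_space_iff)
  moreover have "AE x in lebesgue. x \<notin> {x :: real ^ 'n. \<forall>i. x $ i \<in> \<rat>}"
    using null_sets_completionI[OF countable_imp_null_set_lborel[OF countable_rational_points]]
    by (rule AE_not_in)
  ultimately have "AE x in lebesgue. x \<notin> \<Omega>"
  proof eventually_elim
    case (elim x)
    show ?case
    proof
      assume "x \<in> \<Omega>"
      obtain i where "x $ i \<notin> \<rat>"
        using elim(2) by blast
      \<comment> \<open>The finite value of \<open>\<psi>\<close> at this point is taken as the
        level \<open>M\<close> to be exceeded.\<close>
      then obtain t where "t > m" "\<nu> \<Omega> \<sigma> t x > \<psi> x"
        using \<nu>_unbounded[OF assms(2,4) \<open>x \<in> \<Omega>\<close> _ \<sigma>] by blast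
      then show False
        using elim(1) \<open>x \<in> \<Omega>\<close> by (auto dest!: spec[of _ "t - m"])
    qed
  qed
  \<comment> \<open>Almost every point lies outside \<open>\<Omega>\<close>, which is impossible for
    a nonempty open set.\<close>
  then have "negligible \<Omega>"
    using \<open>\<Omega> \<in> sets lebesgue\<close> by (simp add: negligible_iff_null_sets AE_iff_null_sets)
  then show False
    using open_not_negligible assms(2,5) by blast
qed

end
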